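(* Let $p$ be a prime and let $A,B\subset GF(p)$ be sets with $|A|\ge 2$, $|B|\ge 2$ and $|A||B|<p$. Then the set of points $A\times B\subset AG(2,p)$ determines at least $|A||B|-\min\{|A|,|B|\}+2$ directions.
   Context: $AG(2,p)$ is the affine plane over $GF(p)$, with points $(a,b)$, $a,b\in GF(p)$. For a set $U=\{(a_i,b_i)\}\subset AG(2,p)$, the set of directions determined by $U$ is $D=\left\{\frac{b_i-b_j}{a_i-a_j} : (a_i,b_i)\neq(a_j,b_j)\in U\right\}\subseteq GF(p)\cup\{\infty\}$, where the quotient is $\infty$ when $a_i=a_j$; equivalently, a direction is determined by $U$ if some line in that direction contains two distinct points of $U$. *)

theory Defs
  imports Complex_Main "HOL-Library.Cardinality" "HOL-Computational_Algebra.Primes"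
begin

text \<open>
  The affine plane over a field \<open>'a\<close> is the type \<open>'a \<times> 'a\<close>; its directions are the
  elements of \<open>'a\<close> together with one further element \<open>\<infinity>\<close>, the direction of the vertical lines.
\<close>

datatype 'a direction = Slope 'a | Infinity

definition direction_of :: "'a::field \<times> 'a \<Rightarrow> 'a \<times> 'a \<Rightarrow> 'a direction" where
  "direction_of P Q =
     (if fst P = fst Q then Infinity else Slope ((snd P - snd Q) / (fst P - fst Q)))"

definition directions :: "('a::field \<times> 'a) set \<Rightarrow> 'a direction set" where
  "directions U = {direction_of P Q | P Q. P \<in> U \<and> Q \<in> U \<and> P \<noteq> Q}"

end

theory Submission
  imports Defs "HOL-Computational_Algebra.Polynomial"
begin

text \<open>
  Let \<open>m = |A|\<close>, \<open>n = |B|\<close> and let \<open>D\<close> be the set of directions. The Redei polynomial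
  \<open>H(x, y) = \<Prod>(x + a y - b)\<close> has total degree \<open>m n\<close> and is monic in \<open>x\<close>, so the remainder
  \<open>R(x, y)\<close> of \<open>x\<^sup>p\<close> modulo \<open>H\<close> has total degree at most \<open>p\<close>. If \<open>y\<close> is not a direction, then
  \<open>H(x, y)\<close> has distinct roots, hence divides \<open>x\<^sup>p - x\<close>, so that \<open>R(x, y) = x\<close>. For \<open>i \<ge> |D|\<close> the
  coefficient of \<open>x\<^sup>i\<close> in \<open>R\<close> is thus a polynomial in \<open>y\<close> of degree at most \<open>p - i\<close> with
  \<open>p + 1 - |D|\<close> zeros, so it vanishes identically, and \<open>R(x, 0)\<close> has degree less than \<open>|D|\<close>.

  But \<open>H(x, 0) = \<Prod>(x - b)\<^sup>m\<close> divides \<open>x\<^sup>p - R(x, 0)\<close>; differentiating, \<open>\<Prod>(x - b)\<^sup>m\<^sup>-\<^sup>1\<close> divides the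
  derivative of \<open>R(x, 0)\<close>, which is nonzero since \<open>x\<^sup>p - c\<close> has just one root. Comparing degrees
  gives \<open>n (m - 1) \<le> |D| - 2\<close>, and exchanging \<open>A\<close> and \<open>B\<close> gives \<open>m (n - 1) \<le> |D| - 2\<close>.
\<close>

section \<open>Finite prime fields\<close>

text \<open>The translation by 1 permutes the field, so summing all elements gives
  \<open>of_nat CARD('a) = 0\<close>; the characteristic is then a divisor of a prime other than
  1.\<close>

lemma CHAR_eq_CARD_if_prime:
  assumes "prime CARD('a::field)"
  shows "CHAR('a) = CARD('a)"
proof -
  have "(\<Sum>x::'a\<in>UNIV. x) = (\<Sum>x::'a\<in>UNIV. x + 1)"
    by (rule sum.reindex_bij_witness[of _ "\<lambda>x. x + 1" "\<lambda>x. x - 1"]) auto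
  then have "of_nat CARD('a) = (0 :: 'a)" by (simp add: sum.distrib)
  then have "CHAR('a) dvd CARD('a)" by (simp add: of_nat_eq_0_iff_char_dvd)
  moreover have "CHAR('a) \<noteq> 1" by (simp add: CHAR_not_1)
  ultimately show ?thesis using assms by (metis One_nat_def prime_nat_iff)
qed

text \<open>Multiplication by a nonzero \<open>x\<close> permutes the nonzero elements; compare
  their products before and after.\<close>

lemma finite_field_power_CARD:
  fixes x :: "'a::field"
  assumes fin: "finite (UNIV :: 'a set)"
  shows "x ^ CARD('a) = x"
proof (cases "x = 0")
  case True
  have "CARD('a) > 0" using fin by (simp add: card_gt_0_iff)
  then show ?thesis using True by simp
next
  case False
  let ?S = "UNIV - {0::'a}"
  have "\<Prod>?S = (\<Prod>y\<in>?S. x * y)"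
    by (rule prod.reindex_bij_witness[of _ "\<lambda>y. x * y" "\<lambda>y. y / x"]) (use False in simp_all)
  also have "\<dots> = x ^ card ?S * \<Prod>?S" by (simp only: prod.distrib prod_constant)
  finally have eq: "x ^ card ?S * \<Prod>?S = 1 * \<Prod>?S" by (simp only: mult_1)
  have "\<Prod>?S \<noteq> 0" using fin by (subst prod_zero_iff) auto
  then have "x ^ card ?S = 1" using eq by (simp only: mult_cancel_right simp_thms)
  moreover have "CARD('a) = Suc (card ?S)"
    using card.remove[OF fin UNIV_I] .
  ultimately show ?thesis by (simp only: power_Suc mult_1_right)
qed

section \<open>Families of polynomials of bounded total degree\<close>

text \<open>
  A bivariate polynomial is represented as a map from values of \<open>y\<close> to polynomials in \<open>x\<close>;
  the predicate says that it is given by a polynomial in \<open>x\<close> and \<open>y\<close> of total degree at most \<open>k\<close>.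
\<close>

definition total_degree_le :: "nat \<Rightarrow> ('a::field \<Rightarrow> 'a poly) \<Rightarrow> bool" where
  "total_degree_le k F \<longleftrightarrow>
     (\<forall>i. \<exists>q. (\<forall>y. coeff (F y) i = poly q y) \<and> (q \<noteq> 0 \<longrightarrow> i + degree q \<le> k))"

lemma total_degree_leE:
  assumes "total_degree_le k F"
  obtains q where "\<And>i y. coeff (F y) i = poly (q i) y" "\<And>i. q i \<noteq> 0 \<Longrightarrow> i + degree (q i) \<le> k"
proof -
  from assms have "\<exists>q. \<forall>i. (\<forall>y. coeff (F y) i = poly (q i) y) \<and> (q i \<noteq> 0 \<longrightarrow> i + degree (q i) \<le> k)"
    unfolding total_degree_le_def by (rule choice)
  then show ?thesis using that by blast
qed

lemma total_degree_le_one: "total_degree_le k (\<lambda>y. 1)"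
  unfolding total_degree_le_def
proof
  fix i
  show "\<exists>q. (\<forall>y. coeff 1 i = poly q y) \<and> (q \<noteq> 0 \<longrightarrow> i + degree q \<le> k)"
    by (rule exI[of _ "if i = 0 then 1 else 0"]) (auto simp: coeff_1)
qed

lemma total_degree_le_monic_linear: "total_degree_le (Suc 0) (\<lambda>y. [:a * y - b, 1:])"
  unfolding total_degree_le_def
proof
  fix i
  show "\<exists>q. (\<forall>y. coeff [:a * y - b, 1:] i = poly q y) \<and> (q \<noteq> 0 \<longrightarrow> i + degree q \<le> Suc 0)"
    by (rule exI[of _ "if i = 0 then [:-b, a:] else if i = 1 then 1 else 0"])
       (auto simp: coeff_pCons split: nat.splits)
qed

lemma total_degree_le_diff:
  assumes "total_degree_le k F" "total_degree_le k G"
  shows "total_degree_le k (\<lambda>y. F y - G y)"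
proof -
  obtain q where q: "\<And>i y. coeff (F y) i = poly (q i) y" "\<And>i. q i \<noteq> 0 \<Longrightarrow> i + degree (q i) \<le> k"
    using assms(1) by (rule total_degree_leE) blast
  obtain r where r: "\<And>i y. coeff (G y) i = poly (r i) y" "\<And>i. r i \<noteq> 0 \<Longrightarrow> i + degree (r i) \<le> k"
    using assms(2) by (rule total_degree_leE) blast
  have "i + degree (q i - r i) \<le> k" if "q i - r i \<noteq> 0" for i
  proof (cases "i \<le> k")
    case True
    then have "degree (q i) \<le> k - i" "degree (r i) \<le> k - i"
      using q(2)[of i] r(2)[of i] by force+
    then show ?thesis using True degree_diff_le[of "q i" "k - i" "r i"] by linarith
  next
    case False
    then show ?thesis using that q(2)[of i] r(2)[of i] by force
  qed
  then show ?thesis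
    unfolding total_degree_le_def using q(1) r(1) by (intro allI exI[of _ "q _ - r _"]) auto
qed

lemma total_degree_le_mult:
  assumes "total_degree_le k F" "total_degree_le l G"
  shows "total_degree_le (k + l) (\<lambda>y. F y * G y)"
proof -
  obtain q where q: "\<And>i y. coeff (F y) i = poly (q i) y" "\<And>i. q i \<noteq> 0 \<Longrightarrow> i + degree (q i) \<le> k"
    using assms(1) by (rule total_degree_leE) blast
  obtain r where r: "\<And>i y. coeff (G y) i = poly (r i) y" "\<And>i. r i \<noteq> 0 \<Longrightarrow> i + degree (r i) \<le> l"
    using assms(2) by (rule total_degree_leE) blast
  define s where "s i = (\<Sum>j\<le>i. q j * r (i - j))" for i
  have term_le: "i + degree (q j * r (i - j)) \<le> k + l" if "j \<le> i" "q j * r (i - j) \<noteq> 0" for i j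
    using that q(2)[of j] r(2)[of "i - j"] degree_mult_le[of "q j" "r (i - j)"] by force
  have "i + degree (s i) \<le> k + l" if "s i \<noteq> 0" for i
  proof -
    obtain j where "j \<le> i" "q j * r (i - j) \<noteq> 0"
      using \<open>s i \<noteq> 0\<close> unfolding s_def by (meson atMost_iff sum.neutral)
    then have "i \<le> k + l" using term_le by (meson add_leD1)
    \<comment> \<open>Subtraction on \<open>nat\<close> truncates, so this bound needs
      \<open>i \<le> k + l\<close>, which a nonzero summand of \<open>s i\<close> provides.\<close>
    moreover have "degree (s i) \<le> k + l - i"
      unfolding s_def
    proof (rule degree_sum_le)
      fix j assume "j \<in> {..i}"
      then show "degree (q j * r (i - j)) \<le> k + l - i"
        using term_le[of j i] by (cases "q j * r (i - j) = 0") auto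
    qed simp
    ultimately show ?thesis by linarith
  qed
  moreover have "coeff (F y * G y) i = poly (s i) y" for i y
    by (simp add: coeff_mult q(1) r(1) s_def poly_sum)
  ultimately show ?thesis unfolding total_degree_le_def by blast
qed

lemma total_degree_le_prod:
  assumes "finite S" "\<And>s. s \<in> S \<Longrightarrow> total_degree_le (Suc 0) (F s)"
  shows "total_degree_le (card S) (\<lambda>y. \<Prod>s\<in>S. F s y)"
  using assms
proof (induction S rule: finite_induct)
  case empty
  then show ?case by (simp add: total_degree_le_one)
next
  case (insert s S)
  then have "total_degree_le (Suc 0 + card S) (\<lambda>y. F s y * (\<Prod>s\<in>S. F s y))"
    by (intro total_degree_le_mult) auto
  then show ?case using insert.hyps by simp
qed

lemma total_degree_le_pCons_0:
  assumes "total_degree_le k F"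
  shows "total_degree_le (Suc k) (\<lambda>y. pCons 0 (F y))"
proof -
  have "total_degree_le (Suc 0 + k) (\<lambda>y. [:0 * y - 0, 1:] * F y)"
    by (rule total_degree_le_mult[OF total_degree_le_monic_linear assms])
  then show ?thesis by simp
qed

text \<open>For the term subtracted in one step of polynomial division: the coefficient, unless
  zero, has degree at most \<open>k - i\<close> in \<open>y\<close>, which \<open>G\<close> raises
  by at most \<open>i + 1\<close>.\<close>

lemma total_degree_le_coeff_smult:
  assumes "total_degree_le k F" "total_degree_le (Suc i) G"
  shows "total_degree_le (Suc k) (\<lambda>y. smult (coeff (F y) i) (G y))"
proof -
  obtain q where q: "\<And>y. coeff (F y) i = poly q y" "q \<noteq> 0 \<Longrightarrow> i + degree q \<le> k"
    using assms(1) unfolding total_degree_le_def by blast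
  obtain r where r: "\<And>j y. coeff (G y) j = poly (r j) y" "\<And>j. r j \<noteq> 0 \<Longrightarrow> j + degree (r j) \<le> Suc i"
    using assms(2) by (rule total_degree_leE) blast
  have "j + degree (q * r j) \<le> Suc k" if "q * r j \<noteq> 0" for j
    using that q(2) r(2)[of j] degree_mult_le[of q "r j"] by force
  then show ?thesis
    unfolding total_degree_le_def using q(1) r(1) by (intro allI exI[of _ "q * r _"]) auto
qed

text \<open>Reduction modulo a monic polynomial never divides by a polynomial in \<open>y\<close>,
  so the remainder stays polynomial in \<open>y\<close>; each multiplication by \<open>x\<close>
  raises its total degree by at most one.\<close>

lemma power_mod_monic_total_degree_le:
  fixes H :: "'a::field \<Rightarrow> 'a poly"
  assumes H: "total_degree_le d H" and deg: "\<And>y. degree (H y) = d"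
    and monic: "\<And>y. lead_coeff (H y) = 1" and "d > 0"
  obtains R where "total_degree_le k R" "\<And>y. degree (R y) < d" "\<And>y. H y dvd monom 1 k - R y"
proof -
  have "\<exists>R. total_degree_le k R \<and> (\<forall>y. degree (R y) < d \<and> H y dvd monom 1 k - R y)"
  proof (induction k)
    case 0
    show ?case
      using \<open>d > 0\<close> by (intro exI[of _ "\<lambda>y. 1"]) (simp add: total_degree_le_one)
  next
    case (Suc k)
    then obtain R where R: "total_degree_le k R" "\<And>y. degree (R y) < d"
        "\<And>y. H y dvd monom 1 k - R y"
      by blast
    obtain e where e: "d = Suc e" using \<open>d > 0\<close> gr0_implies_Suc by blast
    \<comment> \<open>Multiplying by \<open>x\<close> moves the coefficient at
      \<open>e = d - 1\<close> to degree \<open>d\<close>, where the monic \<open>H y\<close>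
      cancels it.\<close>
    define R' where "R' y = pCons 0 (R y) - smult (coeff (R y) e) (H y)" for y
    have "total_degree_le (Suc k) R'"
      unfolding R'_def using R(1) H e
      by (auto intro: total_degree_le_diff total_degree_le_pCons_0 total_degree_le_coeff_smult)
    moreover have "degree (R' y) < d" for y
    proof -
      have "coeff (R' y) i = 0" if "i > e" for i
      proof (cases "i = d")
        case True
        then show ?thesis using monic[of y] deg[of y] e by (simp add: R'_def)
      next
        case False
        then have "i > d" using that e by simp
        moreover from this obtain j where "i = Suc j" "j \<ge> d"
          using Suc_le_D Suc_le_eq by (metis Suc_le_mono)
        ultimately show ?thesis using R(2)[of y] deg[of y] by (simp add: R'_def coeff_eq_0)
      qed
      then have "degree (R' y) \<le> e" by (simp add: degree_le)
      then show ?thesis using e by simp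
    qed
    moreover have "H y dvd monom 1 (Suc k) - R' y" for y
    proof -
      have "monom 1 (Suc k) - R' y
          = [:0, 1:] * (monom 1 k - R y) + smult (coeff (R y) e) (H y)"
        by (simp add: R'_def monom_Suc)
      then show ?thesis using R(3)[of y] by (metis dvd_add dvd_mult dvd_refl dvd_smult)
    qed
    ultimately show ?case by blast
  qed
  then show ?thesis using that by blast
qed

section \<open>Divisibility by products of linear factors\<close>

text \<open>Induction: by injectivity \<open>g s\<close> is no root of the earlier factors, so it is
  a root of the cofactor.\<close>

lemma prod_distinct_linear_dvd:
  fixes f :: "'a::field poly"
  assumes "finite S" "inj_on g S" "\<And>s. s \<in> S \<Longrightarrow> poly f (g s) = 0"
  shows "(\<Prod>s\<in>S. [:- g s, 1:]) dvd f"
  using assms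
proof (induction S rule: finite_induct)
  case empty
  then show ?case by simp
next
  case (insert s S)
  then obtain q where q: "f = (\<Prod>s\<in>S. [:- g s, 1:]) * q" by (auto elim: dvdE)
  have "poly (\<Prod>s\<in>S. [:- g s, 1:]) (g s) \<noteq> 0"
    using insert.prems(1) insert.hyps by (auto simp: poly_prod inj_on_def)
  moreover have "poly f (g s) = 0" using insert.prems(2) by simp
  ultimately have "[:- g s, 1:] dvd q" using q by (simp add: poly_eq_0_iff_dvd)
  then show ?case
    using q insert.hyps by (simp add: mult.commute mult_dvd_mono del: mult_pCons_left)
qed

text \<open>By the product rule, differentiating \<open>G ^ m * q\<close> costs at most one factor
  \<open>G\<close>.\<close>

lemma power_dvd_pderiv:
  fixes G :: "'a::field poly"
  assumes "G ^ m dvd f"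
  shows "G ^ (m - 1) dvd pderiv f"
proof (cases m)
  case (Suc l)
  obtain q where "f = G ^ m * q" using assms by (elim dvdE)
  then have "pderiv f = G ^ m * pderiv q + q * pderiv (G ^ m)"
    by (simp add: pderiv_mult)
  also have "pderiv (G ^ m) = G ^ l * smult (of_nat m) (pderiv G)"
    unfolding Suc pderiv_power_Suc by simp
  finally have "pderiv f = G ^ l * (G * pderiv q + q * smult (of_nat m) (pderiv G))"
    by (simp add: Suc distrib_left mult_ac del: of_nat_Suc)
  then show ?thesis using Suc by simp
qed simp

section \<open>Directions\<close>

lemma finite_directions:
  assumes "finite U"
  shows "finite (directions U)"
proof (rule finite_subset)
  show "directions U \<subseteq> (\<lambda>(P, Q). direction_of P Q) ` (U \<times> U)"
    unfolding directions_def by auto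
qed (use assms in simp)

text \<open>The action on directions of the reflection that exchanges the coordinates.\<close>

fun swap_direction :: "'a::field direction \<Rightarrow> 'a direction" where
  "swap_direction Infinity = Slope 0"
| "swap_direction (Slope s) = (if s = 0 then Infinity else Slope (inverse s))"

lemma swap_direction_of:
  assumes "P \<noteq> Q"
  shows "direction_of (prod.swap P) (prod.swap Q) = swap_direction (direction_of P Q)"
proof (cases "fst P = fst Q")
  case True
  then have "snd P \<noteq> snd Q" using assms by (simp add: prod_eq_iff)
  then show ?thesis using True by (simp add: direction_of_def)
next
  case False
  then show ?thesis by (simp add: direction_of_def)
qed

lemma card_directions_swap:
  assumes "finite U"
  shows "card (directions (prod.swap ` U)) \<le> card (directions U)"
proof -
  have "directions (prod.swap ` U) \<subseteq> swap_direction ` directions U"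
  proof
    fix x assume "x \<in> directions (prod.swap ` U)"
    then obtain P Q where PQ: "P \<in> U" "Q \<in> U" "P \<noteq> Q"
        and "x = direction_of (prod.swap P) (prod.swap Q)"
      unfolding directions_def by auto
    then have "x = swap_direction (direction_of P Q)" by (simp add: swap_direction_of)
    then show "x \<in> swap_direction ` directions U" using PQ unfolding directions_def by blast
  qed
  then show ?thesis
    using finite_directions[OF assms] by (meson finite_imageI card_mono card_image_le order_trans)
qed

lemma inj_on_intercept:
  assumes "Slope y \<notin> directions U"
  shows "inj_on (\<lambda>P. snd P - fst P * y) U"
proof (rule inj_onI, rule ccontr)
  fix P Q assume PQ: "P \<in> U" "Q \<in> U" "snd P - fst P * y = snd Q - fst Q * y" "P \<noteq> Q"
  have "fst P \<noteq> fst Q" using PQ by (auto simp: prod_eq_iff)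
  then have "(snd P - snd Q) / (fst P - fst Q) = y" using PQ(3) by (simp add: field_simps)
  then have "Slope y = direction_of P Q" using \<open>fst P \<noteq> fst Q\<close> by (simp add: direction_of_def)
  then have "Slope y \<in> directions U" unfolding directions_def using PQ by blast
  with assms show False ..
qed

text \<open>Of the determined directions one is vertical, so exactly
  \<open>card (directions U) - 1\<close> slopes are taken.\<close>

lemma card_nondirections:
  assumes fin: "finite (UNIV :: 'a::field set)" and inf: "Infinity \<in> directions (U :: ('a \<times> 'a) set)"
  shows "card {y. Slope y \<notin> directions U} + card (directions U) = CARD('a) + 1"
proof -
  have D: "directions U = insert Infinity (Slope ` {y. Slope y \<in> directions U})"
    (is "_ = insert _ (_ ` ?E)")
    using inf by (auto simp: image_iff) (metis direction.exhaust)
  have "card (directions U) = Suc (card (Slope ` ?E))"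
    using fin by (subst D, subst card_insert_disjoint) (auto intro: finite_subset)
  also have "card (Slope ` ?E) = card ?E" by (simp add: card_image inj_on_def)
  finally have "card (directions U) = Suc (card ?E)" .
  moreover have "card (- ?E) = CARD('a) - card ?E"
    unfolding Compl_eq_Diff_UNIV using fin by (intro card_Diff_subset) (auto intro: finite_subset)
  moreover have "- ?E = {y. Slope y \<notin> directions U}" by auto
  moreover have "card ?E \<le> CARD('a)" using fin by (simp add: card_mono)
  ultimately show ?thesis by simp
qed

lemma Infinity_in_directions_Times:
  assumes "a \<in> A" "b \<in> B" "b' \<in> B" "b \<noteq> b'"
  shows "Infinity \<in> directions (A \<times> B)"
proof -
  have "direction_of (a, b) (a, b') = Infinity" by (simp add: direction_of_def)
  then show ?thesis using assms unfolding directions_def by force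
qed

lemma Slope_0_in_directions_Times:
  assumes "b \<in> B" "a \<in> A" "a' \<in> A" "a \<noteq> a'"
  shows "Slope 0 \<in> directions (A \<times> B)"
proof -
  have "direction_of (a, b) (a', b) = Slope 0" using assms by (simp add: direction_of_def)
  then show ?thesis using assms unfolding directions_def by force
qed

section \<open>The Redei polynomial\<close>

text \<open>For fixed \<open>y\<close> the roots are the intercepts of the lines of slope
  \<open>y\<close> through points of \<open>U\<close>, with the number of such points as
  multiplicity.\<close>

definition redei_poly :: "('a::field \<times> 'a) set \<Rightarrow> 'a \<Rightarrow> 'a poly" where
  "redei_poly U y = (\<Prod>P\<in>U. [:fst P * y - snd P, 1:])"

lemma degree_redei_poly: "degree (redei_poly U y) = card U"
  unfolding redei_poly_def by (subst degree_prod_sum_eq) auto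

lemma lead_coeff_redei_poly: "lead_coeff (redei_poly U y) = 1"
  unfolding redei_poly_def lead_coeff_prod by (simp add: prod.neutral)

lemma redei_poly_dvd:
  assumes fin: "finite (UNIV :: 'a::field set)" and "Slope y \<notin> directions (U :: ('a \<times> 'a) set)"
  shows "redei_poly U y dvd monom 1 CARD('a) - monom 1 1"
proof -
  have "finite U" using fin by (meson finite_prod finite_subset subset_UNIV)
  then have "(\<Prod>P\<in>U. [:- (snd P - fst P * y), 1:]) dvd monom 1 CARD('a) - monom 1 1"
    using finite_field_power_CARD[OF fin] assms(2)
    by (intro prod_distinct_linear_dvd inj_on_intercept) (auto simp: poly_monom)
  then show ?thesis by (simp add: redei_poly_def)
qed

lemma redei_poly_Times_0:
  assumes "finite A" "finite B"
  shows "redei_poly (A \<times> B) 0 = (\<Prod>b\<in>B. [:-b, 1:]) ^ card A"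
proof -
  have "redei_poly (A \<times> B) 0 = (\<Prod>a\<in>A. \<Prod>b\<in>B. [:-b, 1:])"
    unfolding redei_poly_def by (subst prod.cartesian_product) (auto intro!: prod.cong)
  then show ?thesis by simp
qed

lemma redei_remainder_at_0:
  fixes U :: "('a::field \<times> 'a) set"
  assumes fin: "finite (UNIV :: 'a set)" and inf: "Infinity \<in> directions U"
    and "card U > 1" and D2: "card (directions U) \<ge> 2"
  obtains r where "redei_poly U 0 dvd monom 1 CARD('a) - r" "degree r < card U"
    "degree r < card (directions U)"
proof -
  have U: "finite U" using fin by (meson finite_prod finite_subset subset_UNIV)
  have "total_degree_le (card U) (redei_poly U)"
    unfolding redei_poly_def using U by (intro total_degree_le_prod total_degree_le_monic_linear)
  then obtain R where R: "total_degree_le CARD('a) R" "\<And>y. degree (R y) < card U"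
      "\<And>y. redei_poly U y dvd monom 1 CARD('a) - R y"
    using power_mod_monic_total_degree_le[of "card U" "redei_poly U" "CARD('a)"]
      degree_redei_poly[of U] lead_coeff_redei_poly[of U] \<open>card U > 1\<close>
    by (metis less_trans zero_less_one)
  \<comment> \<open>Remainders are unique: both sides have degree below \<open>card U\<close> and
    are congruent modulo \<open>redei_poly U y\<close>.\<close>
  have R_eq: "R y = monom 1 1" if "Slope y \<notin> directions U" for y
  proof (rule ccontr)
    assume ne: "R y \<noteq> monom 1 1"
    have "redei_poly U y dvd
        (monom 1 CARD('a) - monom 1 1) - (monom 1 CARD('a) - R y)"
      using redei_poly_dvd[OF fin that] R(3)[of y] by (rule dvd_diff)
    then have "redei_poly U y dvd R y - monom 1 1" by simp
    then have "card U \<le> degree (R y - monom 1 1)"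
      using ne dvd_imp_degree_le[of "redei_poly U y" "R y - monom 1 1"]
      by (simp add: degree_redei_poly)
    moreover have "degree (R y - monom 1 1) < card U"
      using R(2)[of y] \<open>card U > 1\<close> by (intro degree_diff_less) (auto simp: degree_monom_eq)
    ultimately show False by simp
  qed
  have coeff_0: "coeff (R 0) i = 0" if i: "i \<ge> card (directions U)" for i
  proof -
    obtain q where q: "\<And>y. coeff (R y) i = poly q y" "q \<noteq> 0 \<Longrightarrow> i + degree q \<le> CARD('a)"
      using R(1) unfolding total_degree_le_def by blast
    have "q = 0"
    proof (rule ccontr)
      assume "q \<noteq> 0"
      \<comment> \<open>Here \<open>i \<ge> 2\<close>, so the coefficient of \<open>x^i\<close> in
        the remainder \<open>x\<close> is zero.\<close>
      have "{y. Slope y \<notin> directions U} \<subseteq> {y. poly q y = 0}"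
        using R_eq q(1) i D2 by (auto simp flip: q(1))
      then have "card {y. Slope y \<notin> directions U} \<le> card {y. poly q y = 0}"
        using fin by (intro card_mono) (auto intro: finite_subset)
      also have "\<dots> \<le> degree q" using \<open>q \<noteq> 0\<close> by (rule card_poly_roots_bound)
      finally show False
        using q(2)[OF \<open>q \<noteq> 0\<close>] card_nondirections[OF fin inf] i by linarith
    qed
    then show ?thesis using q(1) by simp
  qed
  have "degree (R 0) < card (directions U)"
  proof (rule ccontr)
    assume ge: "\<not> degree (R 0) < card (directions U)"
    then have "R 0 = 0" using coeff_0[of "degree (R 0)"] by simp
    then show False using ge D2 by simp
  qed
  then show ?thesis using that R(2,3) by blast
qed

section \<open>The lower bound for Cartesian products\<close>

lemma card_directions_Times_ge:
  fixes A B :: "'a::field set"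
  assumes prime: "prime CARD('a)" and A: "card A \<ge> 2" and B: "card B \<ge> 2"
    and lt: "card A * card B < CARD('a)"
  shows "card A * card B - card B + 2 \<le> card (directions (A \<times> B))"
proof -
  have fin: "finite (UNIV :: 'a set)" using prime by (metis card.infinite not_prime_0)
  then have finA: "finite A" and finB: "finite B" by (auto intro: finite_subset)
  obtain a a' where a: "a \<in> A" "a' \<in> A" "a \<noteq> a'"
    using A by (metis card_le_Suc0_iff_eq finA not_less_eq_eq numeral_2_eq_2)
  obtain b b' where b: "b \<in> B" "b' \<in> B" "b \<noteq> b'"
    using B by (metis card_le_Suc0_iff_eq finB not_less_eq_eq numeral_2_eq_2)
  let ?D = "directions (A \<times> B)"
  have inf: "Infinity \<in> ?D" using a b by (blast intro: Infinity_in_directions_Times)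
  have "Slope 0 \<in> ?D" using a b by (blast intro: Slope_0_in_directions_Times)
  then have "card {Infinity, Slope (0::'a)} \<le> card ?D"
    using inf finite_directions[of "A \<times> B"] finA finB by (intro card_mono) simp_all
  then have D2: "card ?D \<ge> 2" by simp
  have "card A * card B \<ge> 2 * 2" using A B by (rule mult_le_mono)
  then have "card (A \<times> B) > 1" by (simp add: card_cartesian_product)
  then obtain r where r: "redei_poly (A \<times> B) 0 dvd monom 1 CARD('a) - r"
      "degree r < card A * card B" "degree r < card ?D"
    using redei_remainder_at_0[OF fin inf _ D2] by (metis card_cartesian_product)
  define G where "G = (\<Prod>b\<in>B. [:-b, 1:])"
  have dvd: "G ^ card A dvd monom 1 CARD('a) - r"
    using r(1) finA finB by (simp add: redei_poly_Times_0 G_def)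
  have char: "CHAR('a) = CARD('a)" using prime by (rule CHAR_eq_CARD_if_prime)
  \<comment> \<open>In characteristic p the derivative of \<open>x^p\<close> vanishes.\<close>
  have "pderiv (monom 1 CARD('a) - r) = - pderiv r"
    by (simp add: pderiv_diff pderiv_monom flip: char)
  then have dvd': "G ^ (card A - 1) dvd pderiv r"
    using power_dvd_pderiv[OF dvd] by simp
  have "pderiv r \<noteq> 0"
  proof
    assume "pderiv r = 0"
    \<comment> \<open>Below p the factor \<open>Suc i\<close> is invertible; from p on,
      \<open>r\<close> has no terms, as its degree is below
      \<open>card A * card B < p\<close>.\<close>
    have "coeff r (Suc i) = 0" for i
    proof (cases "Suc i < CARD('a)")
      case True
      then have "\<not> CARD('a) dvd Suc i" by (auto dest: dvd_imp_le)
      then have "of_nat (Suc i) \<noteq> (0 :: 'a)" by (metis of_nat_eq_0_iff_char_dvd char)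
      then show ?thesis
        using \<open>pderiv r = 0\<close> coeff_pderiv[of r i] by (simp del: of_nat_Suc)
    next
      case False
      then show ?thesis using r(2) lt by (simp add: coeff_eq_0)
    qed
    then have "degree r = 0"
      by (metis leading_coeff_0_iff degree_0 not0_implies_Suc)
    then obtain c where c: "r = [:c:]" by (rule degree_eq_zeroE)
    \<comment> \<open>Each \<open>s\<close> in \<open>B\<close> is a root of \<open>x^p - c\<close>,
      and \<open>s^p = s\<close>; but \<open>B\<close> has two elements.\<close>
    have "s = c" if "s \<in> B" for s
    proof -
      have "[:-s, 1:] dvd G" unfolding G_def using finB that by (rule dvd_prodI)
      also have "G dvd G ^ card A" using A by (intro dvd_power) simp
      also note dvd
      finally show ?thesis
        by (simp add: c poly_monom finite_field_power_CARD[OF fin] flip: poly_eq_0_iff_dvd)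
    qed
    then show False using b by metis
  qed
  have degG: "degree G = card B" unfolding G_def by (subst degree_prod_sum_eq) auto
  have "card B * (card A - 1) = degree (G ^ (card A - 1))"
    using degG B by (subst degree_power_eq) (auto simp: mult.commute)
  also have "\<dots> \<le> degree (pderiv r)" using dvd' \<open>pderiv r \<noteq> 0\<close> by (rule dvd_imp_degree_le)
  also have "\<dots> \<le> degree r - 1"
    by (rule degree_le) (auto simp: coeff_pderiv coeff_eq_0)
  also have "\<dots> \<le> card ?D - 2" using r(3) by simp
  finally show ?thesis using D2 by (simp add: diff_mult_distrib2 mult.commute)
qed

theorem theorem1:
  fixes p :: nat and A B :: "'a::field set"
  assumes "prime p" and "CARD('a) = p"
    and "card A \<ge> 2" and "card B \<ge> 2"
    and "card A * card B < p"
  shows "card (directions (A \<times> B)) \<ge> card A * card B - min (card A) (card B) + 2"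
proof (cases "card B \<le> card A")
  case True
  then show ?thesis using card_directions_Times_ge[of A B] assms by (simp add: min_absorb2)
next
  case False
  have "finite A" "finite B" using assms(3,4) by (metis card.infinite not_numeral_le_zero)+
  \<comment> \<open>Swapping coordinates makes the smaller set the second factor, whose size the
    bound subtracts.\<close>
  then have "card (directions (B \<times> A)) \<le> card (directions (A \<times> B))"
    using card_directions_swap[of "A \<times> B"] by (simp add: product_swap)
  then show ?thesis
    using False card_directions_Times_ge[of B A] assms by (simp add: min_absorb1 mult.commute)
qed

end
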